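(* Let $(M,*,0,\leq)$ be a dense unital magma and let $(X,d)$ be an $M$-metric space. If a sequence in $X$ is convergent in $X$, then its limit is unique.
   Context: A unital magma $(M,*,0)$ is a set $M$ with a binary operation $*$ (not necessarily associative or commutative) and an element $0$ with $m*0=0*m=m$ for all $m$. An ordered unital magma $(M,*,0,\leq)$ is a unital magma with a partial ordering $\leq$ such that $a\leq b$ implies $a*c\leq b*c$ and $c*a\leq c*b$ for all $a,b,c\in M$. Write $a<b$ if $a\leq b$ and $a\neq b$; $m$ is positive if $0<m$. An ordered unital magma $M$ is a dense unital magma if for every positive $\epsilon\in M$ there are positive $\beta,\gamma\in M$ with $\beta*\gamma<\epsilon$. For an ordered unital magma $M$, $(X,d)$ is an $M$-metric space if $d:X\times X\to M$ satisfies, for all $x,y,z\in X$: (1) $d(x,y)\geq 0$, and $d(x,y)=0$ if and only if $x=y$; (2) $d(x,y)=d(y,x)$; (3) $d(x,z)\leq d(x,y)*d(y,z)$. A sequence $(x_n)$ in $X$ is convergent to $x\in X$ (and $x$ is a limit of it) if for any positive $\epsilon\in M$ there is a natural number $N$ such that $n\geq N$ implies $d(x_n,x)<\epsilon$. *)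

theory Defs
  imports Main
begin

text \<open>
  Carriers are explicit sets: only the behaviour of the operations on \<open>M\<close> (and of the
  distance on \<open>X\<close>) is constrained, so values outside the carriers are irrelevant.
\<close>

locale unital_magma =
  fixes M :: "'m set"
    and mult :: "'m \<Rightarrow> 'm \<Rightarrow> 'm"  (infixl \<open>\<star>\<close> 70)
    and e :: 'm  (\<open>\<zero>\<close>)
  assumes mult_closed: "\<lbrakk>a \<in> M; b \<in> M\<rbrakk> \<Longrightarrow> a \<star> b \<in> M"
    and unit_closed: "\<zero> \<in> M"
    and mult_unit_right: "m \<in> M \<Longrightarrow> m \<star> \<zero> = m"
    and mult_unit_left: "m \<in> M \<Longrightarrow> \<zero> \<star> m = m"

locale ordered_unital_magma = unital_magma M mult e
  for M :: "'m set" and mult (infixl \<open>\<star>\<close> 70) and e (\<open>\<zero>\<close>) +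
  fixes le :: "'m \<Rightarrow> 'm \<Rightarrow> bool"  (infix \<open>\<preceq>\<close> 50)
  assumes le_refl: "reflp_on M (\<preceq>)"
    and le_trans: "transp_on M (\<preceq>)"
    and le_antisym: "antisymp_on M (\<preceq>)"
    and mult_right_mono: "\<lbrakk>a \<in> M; b \<in> M; c \<in> M; a \<preceq> b\<rbrakk> \<Longrightarrow> a \<star> c \<preceq> b \<star> c"
    and mult_left_mono: "\<lbrakk>a \<in> M; b \<in> M; c \<in> M; a \<preceq> b\<rbrakk> \<Longrightarrow> c \<star> a \<preceq> c \<star> b"

definition strictly_less :: "('m \<Rightarrow> 'm \<Rightarrow> bool) \<Rightarrow> 'm \<Rightarrow> 'm \<Rightarrow> bool" where
  "strictly_less le a b \<longleftrightarrow> le a b \<and> a \<noteq> b"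

definition positives :: "'m set \<Rightarrow> 'm \<Rightarrow> ('m \<Rightarrow> 'm \<Rightarrow> bool) \<Rightarrow> 'm set" where
  "positives M e le = {m \<in> M. strictly_less le e m}"

locale dense_unital_magma = ordered_unital_magma M mult e le
  for M :: "'m set" and mult (infixl \<open>\<star>\<close> 70) and e (\<open>\<zero>\<close>) and le (infix \<open>\<preceq>\<close> 50) +
  assumes dense: "\<epsilon> \<in> positives M \<zero> (\<preceq>) \<Longrightarrow>
    \<exists>\<beta>\<in>positives M \<zero> (\<preceq>). \<exists>\<gamma>\<in>positives M \<zero> (\<preceq>). strictly_less (\<preceq>) (\<beta> \<star> \<gamma>) \<epsilon>"

locale magma_metric_space = ordered_unital_magma M mult e le
  for M :: "'m set" and mult (infixl \<open>\<star>\<close> 70) and e (\<open>\<zero>\<close>) and le (infix \<open>\<preceq>\<close> 50) +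
  fixes X :: "'x set" and d :: "'x \<Rightarrow> 'x \<Rightarrow> 'm"
  assumes dist_closed: "\<lbrakk>x \<in> X; y \<in> X\<rbrakk> \<Longrightarrow> d x y \<in> M"
    and dist_nonneg: "\<lbrakk>x \<in> X; y \<in> X\<rbrakk> \<Longrightarrow> \<zero> \<preceq> d x y"
    and dist_eq_zero_iff: "\<lbrakk>x \<in> X; y \<in> X\<rbrakk> \<Longrightarrow> d x y = \<zero> \<longleftrightarrow> x = y"
    and dist_commute: "\<lbrakk>x \<in> X; y \<in> X\<rbrakk> \<Longrightarrow> d x y = d y x"
    and dist_triangle: "\<lbrakk>x \<in> X; y \<in> X; z \<in> X\<rbrakk> \<Longrightarrow> d x z \<preceq> d x y \<star> d y z"

definition converges_to ::
    "'m set \<Rightarrow> 'm \<Rightarrow> ('m \<Rightarrow> 'm \<Rightarrow> bool) \<Rightarrow> 'x set \<Rightarrow> ('x \<Rightarrow> 'x \<Rightarrow> 'm) \<Rightarrow> (nat \<Rightarrow> 'x) \<Rightarrow> 'x \<Rightarrow> bool"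
  where
  "converges_to M e le X d s x \<longleftrightarrow>
     x \<in> X \<and> (\<forall>\<epsilon>\<in>positives M e le. \<exists>N. \<forall>n\<ge>N. strictly_less le (d (s n) x) \<epsilon>)"

end

theory Submission
  imports Defs
begin

text \<open>Changing one factor at a time through \<open>b \<star> c\<close> reduces this to the two
  one-sided monotonicity laws and transitivity.\<close>

lemma (in ordered_unital_magma) mult_mono:
  assumes "a \<in> M" "b \<in> M" "c \<in> M" "f \<in> M" "a \<preceq> b" "c \<preceq> f"
  shows "a \<star> c \<preceq> b \<star> f"
proof -
  have "a \<star> c \<preceq> b \<star> c"
    using assms by (intro mult_right_mono)
  moreover have "b \<star> c \<preceq> b \<star> f"
    using assms by (intro mult_left_mono)
  moreover have "a \<star> c \<in> M" "b \<star> c \<in> M" "b \<star> f \<in> M"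
    using assms by (simp_all add: mult_closed)
  ultimately show ?thesis
    using transp_onD[OF le_trans] by metis
qed

text \<open>If two limits were distinct, their distance \<open>d x y\<close> would be positive, so density gives
  positive \<open>\<beta>\<close>, \<open>\<gamma>\<close> with \<open>\<beta> \<star> \<gamma>\<close> strictly below it, while the triangle inequality through
  a late term of the sequence bounds \<open>d x y\<close> by \<open>\<beta> \<star> \<gamma>\<close>.\<close>

lemma converges_to_unique:
  assumes dense: "dense_unital_magma M mult e le"
    and metric: "magma_metric_space M mult e le X d"
    and s: "\<forall>n. s n \<in> X"
    and x: "converges_to M e le X d s x"
    and y: "converges_to M e le X d s y"
  shows "x = y"
proof (rule ccontr)
  assume "x \<noteq> y"
  interpret T: magma_metric_space M mult e le X d by (fact metric)
  interpret D: dense_unital_magma M mult e le by (fact dense)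
  have X: "x \<in> X" "y \<in> X"
    using x y by (auto simp: converges_to_def)
  have "e \<noteq> d x y"
    using T.dist_eq_zero_iff[OF X] \<open>x \<noteq> y\<close> by simp
  then have "d x y \<in> positives M e le"
    using X T.dist_closed T.dist_nonneg by (simp add: positives_def strictly_less_def)
  then obtain \<beta> \<gamma> where \<beta>: "\<beta> \<in> positives M e le" and \<gamma>: "\<gamma> \<in> positives M e le"
    and less: "strictly_less le (mult \<beta> \<gamma>) (d x y)"
    using D.dense by blast
  have M: "\<beta> \<in> M" "\<gamma> \<in> M"
    using \<beta> \<gamma> by (auto simp: positives_def)
  obtain N1 where N1: "\<forall>n\<ge>N1. strictly_less le (d (s n) x) \<beta>"
    using x \<beta> unfolding converges_to_def by blast
  obtain N2 where N2: "\<forall>n\<ge>N2. strictly_less le (d (s n) y) \<gamma>"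
    using y \<gamma> unfolding converges_to_def by blast
  \<comment> \<open>Beyond both thresholds, a single term is close to both limits at once.\<close>
  define z where "z = s (max N1 N2)"
  have z: "z \<in> X"
    using s by (simp add: z_def)
  \<comment> \<open>Convergence bounds \<open>d z x\<close>; symmetry turns it into the
    \<open>d x z\<close> that the path from \<open>x\<close> through \<open>z\<close> to
    \<open>y\<close> requires.\<close>
  have "le (d x z) \<beta>" "le (d z y) \<gamma>"
    using N1 N2 T.dist_commute[OF X(1) z] by (auto simp: strictly_less_def z_def)
  \<comment> \<open>\<open>rotated 4\<close> moves the two order premises of
    \<open>mult_mono\<close> to the front, where the chained bounds discharge them; only carrier
    memberships remain.\<close>
  then have "le (mult (d x z) (d z y)) (mult \<beta> \<gamma>)"
    by (rule T.mult_mono[rotated 4]) (simp_all add: M X z T.dist_closed)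
  moreover have "le (d x y) (mult (d x z) (d z y))"
    by (rule T.dist_triangle[OF X(1) z X(2)])
  moreover have closed: "d x y \<in> M" "mult (d x z) (d z y) \<in> M" "mult \<beta> \<gamma> \<in> M"
    by (simp_all add: M X z T.dist_closed T.mult_closed)
  ultimately have "le (d x y) (mult \<beta> \<gamma>)"
    using transp_onD[OF T.le_trans] by metis
  \<comment> \<open>Since \<open>less\<close> contains the reverse inequality, antisymmetry forces
    \<open>mult \<beta> \<gamma> = d x y\<close>, which its strictness excludes.\<close>
  with less show False
    using antisymp_onD[OF T.le_antisym closed(3,1)] by (simp add: strictly_less_def)
qed

theorem proposition3p8:
  fixes M :: "'m set" and mult :: "'m \<Rightarrow> 'm \<Rightarrow> 'm" and e :: 'm and le :: "'m \<Rightarrow> 'm \<Rightarrow> bool"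
    and X :: "'x set" and d :: "'x \<Rightarrow> 'x \<Rightarrow> 'm" and s :: "nat \<Rightarrow> 'x"
  assumes "dense_unital_magma M mult e le"
    and "magma_metric_space M mult e le X d"
    and "\<forall>n. s n \<in> X"
    and "\<exists>x. converges_to M e le X d s x"
  shows "\<exists>!x. converges_to M e le X d s x"
  using assms(4) converges_to_unique[OF assms(1-3)] by (rule ex_ex1I)

end
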